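(* Let $1<p<\infty$ and let $\mathbf{b}=(b_j)_{j=1}^\infty$ be a nonnegative sequence with infinitely many positive terms $b_j$. Then the sequence $\left(\frac{|\mathbf{s}|_1!}{\mathbf{s}!}\,\mathbf{b}^{\mathbf{s}}\right)_{\mathbf{s}\in\mathbb{F}}$ belongs to $\ell_p(\mathbb{F})$ if and only if $\|\mathbf{b}\|_{\ell_1(\mathbb{N})}\le 1$.
   Context: $\mathbb{F}$ denotes the set of all sequences $\mathbf{s}=(s_j)_{j=1}^\infty$ of nonnegative integers with finite support $\operatorname{supp}(\mathbf{s})=\{j\in\mathbb{N}: s_j\neq 0\}$. For $\mathbf{s}\in\mathbb{F}$: $\mathbf{s}!:=\prod_{j=1}^\infty s_j!$, $|\mathbf{s}|_1:=\sum_{j=1}^\infty s_j$, and $\mathbf{b}^{\mathbf{s}}:=\prod_{j=1}^\infty b_j^{s_j}$ (with $0^0=1$). A family $(c_{\mathbf{s}})_{\mathbf{s}\in\mathbb{F}}$ belongs to $\ell_p(\mathbb{F})$ if $\sum_{\mathbf{s}\in\mathbb{F}}|c_{\mathbf{s}}|^p<\infty$. $\|\mathbf{b}\|_{\ell_1(\mathbb{N})}=\sum_{j\ge1}|b_j|$ (possibly $+\infty$). *)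

theory Defs
  imports "HOL-Analysis.Analysis"
begin

text \<open>Sequences are indexed by \<open>nat\<close>: the \<open>j\<close>-th term in the usual numbering
  \<open>j = 1, 2, \<dots>\<close> is the value at \<open>j - 1\<close>.\<close>

definition supp :: "(nat \<Rightarrow> nat) \<Rightarrow> nat set" where
  "supp s = {j. s j \<noteq> 0}"

definition finsupp_seqs :: "(nat \<Rightarrow> nat) set" where
  "finsupp_seqs = {s. finite (supp s)}"

text \<open>The sums and products over all indices below are taken over the support; the
  remaining summands are \<open>0\<close> and the remaining factors are \<open>0! = 1\<close> and \<open>b j ^ 0 = 1\<close>
  (also when \<open>b j = 0\<close>).\<close>

definition multi_fact :: "(nat \<Rightarrow> nat) \<Rightarrow> nat" where
  "multi_fact s = (\<Prod>j\<in>supp s. fact (s j))"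

definition multi_abs :: "(nat \<Rightarrow> nat) \<Rightarrow> nat" where
  "multi_abs s = (\<Sum>j\<in>supp s. s j)"

definition multi_power :: "(nat \<Rightarrow> real) \<Rightarrow> (nat \<Rightarrow> nat) \<Rightarrow> real" where
  "multi_power b s = (\<Prod>j\<in>supp s. b j ^ s j)"

definition in_lp :: "real \<Rightarrow> 'i set \<Rightarrow> ('i \<Rightarrow> real) \<Rightarrow> bool" where
  "in_lp p I c \<longleftrightarrow> (\<lambda>i. \<bar>c i\<bar> powr p) summable_on I"

definition l1_norm :: "(nat \<Rightarrow> real) \<Rightarrow> ennreal" where
  "l1_norm b = (\<Sum>j. ennreal \<bar>b j\<bar>)"

end

theory Submission
  imports Defs
begin

text \<open>Write \<open>c s\<close> for the term \<open>|s|! / s! b\<^sup>s\<close>. By the multinomial theorem the terms with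
  \<open>|s| = n\<close> and support in a finite set \<open>A\<close> add up to \<open>(\<Sum>j\<in>A. b j) ^ n\<close>.

  If \<open>\<Sum>j\<in>A. b j > 1\<close> for some finite \<open>A\<close>, this total grows exponentially in \<open>n\<close>,
  while it has at most \<open>(n + 1) ^ card A\<close> summands. So the terms are unbounded and lie in
  no \<open>\<ell>\<^sub>p\<close> (lemma \<open>multinomial_term_unbounded\<close>).

  Conversely, let \<open>\<Sum>j. b j \<le> 1\<close>. Then the terms with \<open>|s| = n\<close> behave like multinomial
  probabilities: their sum is at most \<open>1\<close>, uniformly in \<open>n\<close>. Put \<open>a = p - 1 > 0\<close>.
  In \<open>c s powr p = c s * c s powr a\<close> the factor \<open>c s powr a\<close> must supply decay in \<open>n\<close>. With
  \<open>g m = m! e\<^sup>m / m\<^sup>m\<close>, the bound \<open>y \<le> exp (y - 1)\<close> at \<open>y = b j * n / s j\<close> in each coordinate gives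
  \<open>c s \<le> g |s| / (\<Prod>j\<in>J. g (s j))\<close> for every finite set \<open>J\<close> of indices
  (\<open>multinomial_term_le_stirling\<close>). Stirling's formula has \<open>g m\<close> of order \<open>sqrt m\<close>, but any two
  powers of \<open>m + 1\<close> as bounds suffice, here \<open>(m + 1) powr (1/5) \<le> g m \<le> e (m + 1)\<close>. Typically
  each \<open>s j\<close> with \<open>b j > 0\<close> is of order \<open>n\<close>, so each index in \<open>J\<close> contributes a fixed negative
  power of \<open>n\<close>, and since infinitely many \<open>b j\<close> are positive, \<open>J\<close> can be taken so large that the
  terms of degree \<open>n\<close> contribute \<open>O(1 / (n + 1)\<^sup>2)\<close>.

  The atypical \<open>s\<close> are dealt with by averaging instead of by a large deviation estimate. The mean of
  \<open>X s = (\<Prod>j\<in>J. 1 / (s j + 1))\<close> against the weights \<open>c s\<close> can be bounded by \<open>O((n + 1) powr - card J)\<close>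
  because dividing by \<open>s j + 1\<close> only completes a factorial and shifts the multi-index
  (\<open>sum_multinomial_term_reciprocal_le\<close>), and the mean of a power \<open>X s powr t\<close> with \<open>0 < t \<le> 1\<close> is
  then controlled by concavity (\<open>powr_le_scaled_affine\<close>). The two estimates are combined in
  \<open>sum_multinomial_term_powr_le\<close>.\<close>

section \<open>The multinomial theorem on a finite index set\<close>

definition multi_indices :: "nat set \<Rightarrow> nat \<Rightarrow> (nat \<Rightarrow> nat) set" where
  "multi_indices A n = {s. supp s \<subseteq> A \<and> sum s A = n}"

lemma binomial_exponential: 
  fixes x y :: real shows "(\<Sum>k\<le>n. (x ^ k / fact k) * (y ^ (n - k) / fact (n - k))) = (x + y) ^ n / fact n"
  unfolding binomial_ring sum_divide_distrib
  by (intro sum.cong) (auto simp: binomial_fact field_simps)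

text \<open>Splitting off the value at \<open>x\<close>; this drives the inductions over \<open>A\<close> below.\<close>

lemma multi_indices_insert:
  assumes "finite A" "x \<notin> A"
  shows "bij_betw (\<lambda>(k, s). s(x := k)) (SIGMA k:{..n}. multi_indices A (n - k)) (multi_indices (insert x A) n)"
proof -
  have e: "sum (s(x := k)) A = sum s A" for s :: "nat \<Rightarrow> nat" and k
    using assms by (intro sum.cong) auto
  show ?thesis
  proof (rule bij_betwI[where g = "\<lambda>s. (s x, s(x := 0))"])
    show "(\<lambda>(k, s). s(x := k)) \<in> (SIGMA k:{..n}. multi_indices A (n - k)) \<rightarrow> multi_indices (insert x A) n"
      using assms by (auto simp: multi_indices_def supp_def e simp del: fun_upd_apply split: if_splits)
        (auto split: if_splits)
    show "(\<lambda>s. (s x, s(x := 0))) \<in> multi_indices (insert x A) n \<rightarrow> (SIGMA k:{..n}. multi_indices A (n - k))"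
      using assms by (auto simp: multi_indices_def supp_def e simp del: fun_upd_apply split: if_splits)
        (auto split: if_splits)
  qed (use assms in \<open>auto simp: multi_indices_def supp_def fun_eq_iff\<close>)
qed

lemma finite_multi_indices: "finite A \<Longrightarrow> finite (multi_indices A n)"
proof (induction A arbitrary: n rule: finite_induct)
  case empty
  have "multi_indices {} n \<subseteq> {\<lambda>_. 0}" by (auto simp: multi_indices_def supp_def)
  then show ?case by (rule finite_subset) simp
next
  case (insert x A)
  show ?case using bij_betw_finite[OF multi_indices_insert[OF insert.hyps]] insert.IH by auto
qed

lemma card_multi_indices: "finite A \<Longrightarrow> card (multi_indices A n) \<le> (n + 1) ^ card A"
proof (induction A arbitrary: n rule: finite_induct)
  case empty
  have "multi_indices {} n \<subseteq> {\<lambda>_. 0}" by (auto simp: multi_indices_def supp_def)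
  then have "card (multi_indices {} n) \<le> card {\<lambda>_ :: nat. 0 :: nat}" by (intro card_mono) auto
  then show ?case by simp
next
  case (insert x A)
  have "card (multi_indices (insert x A) n) = card (SIGMA k:{..n}. multi_indices A (n - k))"
    using bij_betw_same_card[OF multi_indices_insert[OF insert.hyps]] by simp
  also have "\<dots> = (\<Sum>k\<le>n. card (multi_indices A (n - k)))"
    using insert.hyps finite_multi_indices by simp
  also have "\<dots> \<le> (\<Sum>k\<le>n. (n + 1) ^ card A)"
    by (intro sum_mono order.trans[OF insert.IH] power_mono) auto
  finally show ?case using insert.hyps by simp
qed

text \<open>In terms of the normalised powers \<open>x ^ k / k!\<close> the multinomial theorem is an iterated
  convolution, so that adding one index is exactly one use of the binomial theorem.\<close>

lemma multinomial_exponential: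
  fixes b :: "nat \<Rightarrow> real"
  shows "finite A \<Longrightarrow> (\<Sum>s\<in>multi_indices A n. \<Prod>j\<in>A. b j ^ s j / fact (s j)) = sum b A ^ n / fact n"
proof (induction A arbitrary: n rule: finite_induct)
  case empty
  have "multi_indices {} n = (if n = 0 then {\<lambda>_. 0} else {})" by (auto simp: multi_indices_def supp_def)
  then show ?case by (simp add: power_0_left)
next
  case (insert x A)
  have "(\<Sum>s\<in>multi_indices (insert x A) n. \<Prod>j\<in>insert x A. b j ^ s j / fact (s j))
     = (\<Sum>(k, s)\<in>(SIGMA k:{..n}. multi_indices A (n - k)).
          \<Prod>j\<in>insert x A. b j ^ (s(x := k)) j / fact ((s(x := k)) j))"
    by (subst sum.reindex_bij_betw[OF multi_indices_insert[OF insert.hyps], symmetric])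
      (simp add: case_prod_unfold)
  also have "\<dots> = (\<Sum>(k, s)\<in>(SIGMA k:{..n}. multi_indices A (n - k)).
      b x ^ k / fact k * (\<Prod>j\<in>A. b j ^ s j / fact (s j)))"
  proof -
    have "(\<Prod>j\<in>A. b j ^ (s(x := k)) j / fact ((s(x := k)) j))
        = (\<Prod>j\<in>A. b j ^ s j / fact (s j))" for s k
      using insert.hyps by (intro prod.cong) auto
    then show ?thesis using insert.hyps by (simp del: fun_upd_apply add: case_prod_unfold) simp
  qed
  also have "\<dots> = (\<Sum>k\<le>n. b x ^ k / fact k * (sum b A ^ (n - k) / fact (n - k)))"
    using insert.hyps finite_multi_indices
    by (simp only: sum.Sigma[symmetric] sum_distrib_left[symmetric] insert.IH finite_atMost
      simp_thms Ball_def prod.case)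
  also have "\<dots> = (b x + sum b A) ^ n / fact n" by (rule binomial_exponential)
  finally show ?case using insert.hyps by simp
qed

section \<open>Polynomial bounds for the Stirling ratio\<close>

text \<open>By Stirling's formula this is asymptotic to \<open>sqrt (2 \<pi> m)\<close>; its value at \<open>0\<close> is \<open>1\<close>, because
  \<open>0 ^ 0 = 1\<close>.\<close>

definition stirling_ratio :: "nat \<Rightarrow> real" where
  "stirling_ratio m = fact m * exp (real m) / real m ^ m"

text \<open>The slack against \<open>ln (1 + x) \<le> x\<close> makes the Stirling ratio grow at least like a power: it
  yields \<open>(m + 1/5) ln (1 + 1/m) \<le> 1\<close>. Any smaller positive constant in place of
  \<open>1/5\<close> would do; the argument, \<open>ln (1 + x) = 2 ln (sqrt (1 + x)) \<le> 2 (sqrt (1 + x) - 1)\<close>, admits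
  every \<open>\<beta> > 0\<close> with \<open>\<beta> + \<beta>\<^sup>2 \<le> 1/4\<close>.\<close>

lemma ln_one_plus_le:
  fixes x :: real assumes "0 < x" "x \<le> 1" shows "ln (1 + x) \<le> x / (1 + x / 5)"
proof -
  have sq: "sqrt (1 + x) \<le> 1 + x / (2 + 2 * x / 5)"
  proof (rule real_le_lsqrt)
    have "x * x \<le> x * 1" using assms by (intro mult_left_mono) auto
    moreover have "(1 + x / (2 + 2 * x / 5))\<^sup>2 - (1 + x) = x * (x / 4 - x/5 - x * x / 25) / (1 + x / 5)\<^sup>2"
      using assms by (simp add: divide_simps power2_eq_square) (simp add: algebra_simps)
    moreover have "0 \<le> x * (x / 4 - x/5 - x * x / 25) / (1 + x / 5)\<^sup>2"
      using assms \<open>x * x \<le> x * 1\<close> by (intro divide_nonneg_nonneg mult_nonneg_nonneg) auto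
    ultimately show "1 + x \<le> (1 + x / (2 + 2 * x / 5))\<^sup>2" by linarith
  qed (use assms in auto)
  have "ln (1 + x) = 2 * ln (sqrt (1 + x))" using assms by (simp add: ln_sqrt)
  also have "\<dots> \<le> 2 * (sqrt (1 + x) - 1)" using assms ln_le_minus_one[of "sqrt (1 + x)"] by simp
  also have "\<dots> \<le> 2 * (x / (2 + 2 * x / 5))" using sq by simp
  also have "\<dots> = x / (1 + x / 5)" using assms by (simp add: divide_simps)
  finally show ?thesis .
qed

lemma stirling_ratio_pos: "stirling_ratio m > 0" 
  by (cases m) (auto simp: stirling_ratio_def)

lemma ln_stirling_ratio: "m > 0 \<Longrightarrow> ln (stirling_ratio m) = ln (fact m) + m - m * ln m"
  by (simp add: stirling_ratio_def ln_div ln_mult ln_realpow)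

lemma ln_stirling_ratio_Suc:
  assumes "m > 0"
  shows "ln (stirling_ratio (Suc m)) = ln (stirling_ratio m) + (1 - m * ln (1 + 1 / real m))"
proof -
  have "1 + 1 / real m = real (Suc m) / real m" using assms by (simp add: field_simps)
  then have "ln (1 + 1 / real m) = ln (Suc m) - ln (real m)"
    using assms by (simp only: ln_div of_nat_0_less_iff) simp
  moreover have "ln (fact (Suc m) :: real) = ln (Suc m) + ln (fact m)"
    by (simp only: fact_Suc) (simp add: ln_mult)
  ultimately show ?thesis using assms
    by (simp only: ln_stirling_ratio zero_less_Suc of_nat_Suc) (simp add: algebra_simps)
qed

text \<open>For \<open>m > 0\<close> the quotient of the Stirling ratio by \<open>m\<close> is decreasing, because
  \<open>(m + 1) ln (1 + 1/m) \<ge> 1\<close>, and it starts with the value \<open>e\<close> at \<open>m = 1\<close>.\<close>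

lemma stirling_ratio_upper: "stirling_ratio m \<le> exp 1 * (m + 1)"
proof -
  have "ln (stirling_ratio (Suc k)) \<le> 1 + ln (Suc k)" for k
  proof (induction k)
    case (Suc k)
    have "ln (real (Suc k) / Suc (Suc k)) \<le> real (Suc k) / Suc (Suc k) - 1"
      by (intro ln_le_minus_one) auto
    then have "1 / real (Suc (Suc k)) \<le> ln (Suc (Suc k)) - ln (Suc k)"
      by (simp add: ln_div diff_divide_distrib[symmetric] field_simps)
    moreover define d where "d = ln (Suc (Suc k)) - ln (Suc k)"
    ultimately have "1 / real (Suc (Suc k)) \<le> d" by simp
    then have "1 \<le> d * Suc (Suc k)" by (subst (asm) pos_divide_le_eq) auto
    then have "1 \<le> Suc k * d + d" by (simp add: algebra_simps)
    moreover have "1 + 1 / real (Suc k) = real (Suc (Suc k)) / Suc k" by (simp add: field_simps)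
    then have "ln (1 + 1 / real (Suc k)) = d" by (simp add: ln_div d_def)
    ultimately show ?case using Suc ln_stirling_ratio_Suc[of "Suc k"] d_def by simp
  qed (simp add: stirling_ratio_def)
  then have "stirling_ratio (Suc k) \<le> exp 1 * Suc k" for k
    using ln_le_cancel_iff[of "stirling_ratio (Suc k)" "exp 1 * Suc k"] stirling_ratio_pos[of "Suc k"]
    by (simp add: ln_mult)
  then show ?thesis 
  proof (cases m)
    case (Suc k)
    have "exp 1 * real (Suc k) \<le> exp 1 * (real m + 1)" using Suc by (intro mult_left_mono) auto
    with \<open>stirling_ratio (Suc k) \<le> exp 1 * Suc k\<close> show ?thesis unfolding Suc by linarith
  qed (simp add: stirling_ratio_def)
qed

text \<open>The logarithm of the Stirling ratio increases by \<open>1 - m ln (1 + 1/m)\<close> from \<open>m\<close> to \<open>m + 1\<close>, which is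
  at least \<open>1/5 ln (1 + 1/m)\<close> and so at least the increase of \<open>1/5 ln (m + 1)\<close>.\<close>

lemma stirling_ratio_lower: "(m + 1) powr (1 / 5) \<le> stirling_ratio m"
proof -
  have "1 / 5 * ln (m + 1) \<le> ln (stirling_ratio m)"
  proof (induction m)
    case (Suc m)
    show ?case
    proof (cases "m = 0")
      case True
      then show ?thesis using ln_le_minus_one[of "2::real"] by (simp add: stirling_ratio_def)
    next
      case False
      let ?x = "1 / real m"
      have "ln (1 + ?x) \<le> ?x / (1 + ?x / 5)" using False by (intro ln_one_plus_le) auto
      then have "(m + 1 / 5) * ln (1 + ?x) \<le> 1" using False by (simp add: field_simps)
      moreover have "ln (real m + 2) - ln (real m + 1) \<le> ln (1 + ?x)"
      proof -
        have "ln (real m + 2) - ln (real m + 1) = ln ((real m + 2) / (real m + 1))" by (simp add: ln_div)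
        also have "\<dots> \<le> ln (1 + ?x)" using False by (intro ln_mono) (auto simp: field_simps)
        finally show ?thesis .
      qed
      ultimately show ?thesis using Suc ln_stirling_ratio_Suc[of m] False by (simp add: algebra_simps)
    qed
  qed (simp add: stirling_ratio_def)
  then have "exp (1 / 5 * ln (m + 1)) \<le> exp (ln (stirling_ratio m))" by simp
  then show ?thesis using stirling_ratio_pos[of m] by (simp add: powr_def add.commute)
qed

lemma stirling_ratio_ge_1: "1 \<le> stirling_ratio m"
  using stirling_ratio_lower[of m] ge_one_powr_ge_zero[of "real m + 1" "1/5"] by simp

section \<open>Bounding a single term\<close>

text \<open>One coordinate of the bound on \<open>c s\<close>: raise \<open>b n / k \<le> exp (b n / k - 1)\<close> to the power \<open>k\<close>.
  The right-hand sides multiply well over the coordinates, since the \<open>k\<close> add up to \<open>n\<close> and the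
  \<open>b\<close> to at most \<open>1\<close>.\<close>

lemma power_div_fact_le:
  fixes b :: real and n :: nat assumes "0 \<le> b" "k \<le> n"
  shows "b ^ k / fact k \<le> exp (n * b) / (n ^ k * stirling_ratio k)"
proof (cases "k = 0")
  case True
  then show ?thesis using assms by (simp add: stirling_ratio_def)
next
  case False
  have "b * n / k \<le> exp (b * n / k - 1)" using exp_ge_add_one_self[of "b * n / k - 1"] by simp
  then have "(b * n / k) ^ k \<le> exp (b * n / k - 1) ^ k" using assms by (intro power_mono) auto
  also have "\<dots> = exp (b * n - k)" using False 
    by (simp add: exp_of_nat_mult[symmetric] right_diff_distrib)
  finally have "b ^ k * n ^ k * exp k \<le> exp (b * n) * k ^ k"
    using False by (simp add: power_divide power_mult_distrib exp_diff field_simps)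
  then show ?thesis using False assms by (simp add: stirling_ratio_def field_simps)
qed


definition multinomial_term :: "(nat \<Rightarrow> real) \<Rightarrow> (nat \<Rightarrow> nat) \<Rightarrow> real" where
  "multinomial_term b s = real (fact (multi_abs s)) / real (multi_fact s) * multi_power b s"

lemma multinomial_term_eq:
  assumes "finite A" "s \<in> multi_indices A n"
  shows "multinomial_term b s = fact n * (\<Prod>j\<in>A. b j ^ s j / fact (s j))"
proof -
  have s: "supp s \<subseteq> A" "sum s A = n" using assms by (auto simp: multi_indices_def)
  have "multi_abs s = n" unfolding multi_abs_def s(2)[symmetric]
    using assms s by (intro sum.mono_neutral_left) (auto simp: supp_def)
  moreover have "multi_fact s = (\<Prod>j\<in>A. fact (s j))" unfolding multi_fact_def
    using assms s by (intro prod.mono_neutral_left) (auto simp: supp_def)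
  moreover have "multi_power b s = (\<Prod>j\<in>A. b j ^ s j)" unfolding multi_power_def
    using assms s by (intro prod.mono_neutral_left) (auto simp: supp_def)
  ultimately show ?thesis by (simp add: multinomial_term_def prod_dividef)
qed

lemma multinomial_term_nonneg: "(\<And>j. 0 \<le> b j) \<Longrightarrow> 0 \<le> multinomial_term b s"
  by (simp add: multinomial_term_def multi_power_def prod_nonneg)

lemma sum_multinomial_term:
  assumes "finite A"
  shows "(\<Sum>s\<in>multi_indices A n. multinomial_term b s) = sum b A ^ n"
proof -
  have "(\<Sum>s\<in>multi_indices A n. multinomial_term b s)
      = fact n * (\<Sum>s\<in>multi_indices A n. \<Prod>j\<in>A. b j ^ s j / fact (s j))"
    unfolding sum_distrib_left by (intro sum.cong refl multinomial_term_eq assms)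
  then show ?thesis using multinomial_exponential[OF assms] by simp
qed

text \<open>The product of the coordinatewise bounds is \<open>exp (n \<Sum>b) / n ^ n\<close> divided by the Stirling ratios
  of all \<open>s j\<close>, and indices outside \<open>J\<close> may be dropped because every Stirling ratio is at least \<open>1\<close>.\<close>

lemma multinomial_term_le_stirling:
  assumes "finite A" "J \<subseteq> A" "s \<in> multi_indices A n" "\<And>j. 0 \<le> b j" "sum b A \<le> 1"
  shows "multinomial_term b s \<le> stirling_ratio n / (\<Prod>j\<in>J. stirling_ratio (s j))"
proof -
  have s: "sum s A = n" using assms by (auto simp: multi_indices_def)
  have sj: "s j \<le> n" if "j \<in> A" for j using s assms(1) that member_le_sum[of j A s] by auto
  have "(\<Prod>j\<in>A. b j ^ s j / fact (s j)) \<le> (\<Prod>j\<in>A. exp (n * b j) / (n ^ s j * stirling_ratio (s j)))"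
    using assms power_div_fact_le[of "b j" "s j" n for j] sj by (intro prod_mono) auto
  also have "\<dots> = exp (n * sum b A) / (n ^ n * (\<Prod>j\<in>A. stirling_ratio (s j)))"
    using assms s by (simp add: prod_dividef prod.distrib exp_sum sum_distrib_left power_sum[symmetric])
  also have "\<dots> \<le> exp n / (n ^ n * (\<Prod>j\<in>J. stirling_ratio (s j)))"
  proof (intro frac_le mult_left_mono mult_pos_pos)
    show "(\<Prod>j\<in>J. stirling_ratio (s j)) \<le> (\<Prod>j\<in>A. stirling_ratio (s j))"
      using assms stirling_ratio_ge_1 stirling_ratio_pos
      by (intro prod_mono2) (auto intro: less_imp_le)
    show "exp (n * sum b A) \<le> exp n" using assms mult_left_mono[of "sum b A" 1 "real n"] by simp
  qed (auto intro!: prod_pos stirling_ratio_pos)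
  finally have "multinomial_term b s \<le> fact n * (exp n / (n ^ n * (\<Prod>j\<in>J. stirling_ratio (s j))))"
    unfolding multinomial_term_eq[OF assms(1,3)] by (intro mult_left_mono) auto
  then show ?thesis by (simp add: stirling_ratio_def mult.assoc)
qed

section \<open>Summing the powers of the terms of one degree\<close>

lemma fact_add_ge: "fact n * (real n + 1) ^ k \<le> fact (n + k)"
proof (induction k)
  case (Suc k)
  have "fact n * (real n + 1) ^ Suc k = fact n * (real n + 1) ^ k * (real n + 1)" by simp
  also have "\<dots> \<le> fact (n + k) * (real (n + k) + 1)" by (intro mult_mono Suc) auto
  finally show ?case by (simp add: algebra_simps)
qed simp

text \<open>Since \<open>b ^ k / k! * 1 / (k + 1) = b ^ (k + 1) / (k + 1)! / b\<close>, the summand is, up to the factor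
  \<open>n! / (\<Prod>j\<in>J. b j)\<close>, the normalised power of the multi-index raised by one at each index of \<open>J\<close>.
  Its degree is \<open>n + card J\<close>, so the multinomial theorem in that degree bounds the sum.\<close>

lemma sum_multinomial_term_reciprocal_le:
  assumes "finite A" "J \<subseteq> A" "\<And>j. 0 \<le> b j" "\<And>j. j \<in> J \<Longrightarrow> 0 < b j" "sum b A \<le> 1"
  shows "(\<Sum>s\<in>multi_indices A n. multinomial_term b s * (\<Prod>j\<in>J. 1 / (real (s j) + 1)))
    \<le> 1 / (prod b J * (real n + 1) ^ card J)"
proof -
  define w where "w s = (\<Prod>j\<in>A. b j ^ s j / fact (s j))" for s
  define shift where "shift s = (\<lambda>j. s j + of_bool (j \<in> J))" for s :: "nat \<Rightarrow> nat"
  have bJ: "prod b J > 0" using assms by (intro prod_pos) auto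
  have inj: "inj_on shift (multi_indices A n)" 
    by (rule inj_onI) (auto simp: shift_def fun_eq_iff)
  have sh: "shift ` multi_indices A n \<subseteq> multi_indices A (n + card J)"
  proof -
    have "(\<Sum>j\<in>A. of_bool (j \<in> J)) = card J"
      using assms(1,2) by (simp add: of_bool_def sum.If_cases Int_absorb1)
    then show ?thesis using assms(2)
      by (auto simp: shift_def multi_indices_def supp_def sum.distrib)
  qed
  have weq: "multinomial_term b s * (\<Prod>j\<in>J. 1 / (real (s j) + 1)) = fact n / prod b J * w (shift s)"
    if "s \<in> multi_indices A n" for s
  proof -
    have "w (shift s) = (\<Prod>j\<in>A. b j ^ s j / fact (s j) * (if j \<in> J then b j / (real (s j) + 1) else 1))"
      unfolding w_def shift_def by (intro prod.cong) (auto simp: field_simps)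
    also have "\<dots> = w s * (\<Prod>j\<in>J. b j / (real (s j) + 1))"
      unfolding w_def prod.distrib using assms(1,2) by (simp add: prod.If_cases Int_absorb1)
    also have "\<dots> = w s * prod b J * (\<Prod>j\<in>J. 1 / (real (s j) + 1))"
      by (simp add: prod_dividef)
    finally show ?thesis using bJ multinomial_term_eq[OF assms(1) that, of b]
      by (simp add: w_def)
  qed
  have "(\<Sum>s\<in>multi_indices A n. multinomial_term b s * (\<Prod>j\<in>J. 1 / (real (s j) + 1)))
      = (\<Sum>s\<in>multi_indices A n. fact n / prod b J * w (shift s))"
    by (intro sum.cong refl weq)
  also have "\<dots> = fact n / prod b J * (\<Sum>s\<in>shift ` multi_indices A n. w s)"
    by (simp add: sum.reindex[OF inj] sum_distrib_left)
  also have "\<dots> \<le> fact n / prod b J * (\<Sum>s\<in>multi_indices A (n + card J). w s)"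
    using bJ sh assms by (intro mult_left_mono sum_mono2 finite_multi_indices)
      (auto simp: w_def intro!: prod_nonneg)
  also have "\<dots> = fact n / prod b J * (sum b A ^ (n + card J) / fact (n + card J))"
    unfolding w_def multinomial_exponential[OF assms(1)] ..
  also have "\<dots> \<le> fact n / prod b J * (1 / (fact n * (real n + 1) ^ card J))"
    using bJ assms fact_add_ge by (intro mult_left_mono frac_le power_le_one sum_nonneg) auto
  finally show ?thesis by simp
qed

text \<open>A substitute for Jensen's inequality: if the mean of \<open>X\<close> is at most a multiple of \<open>l\<close>, then the
  mean of \<open>X powr t\<close> is at most a multiple of \<open>l powr t\<close>.\<close>

lemma powr_le_scaled_affine:
  fixes X l t :: real assumes "0 \<le> X" "0 < l" "0 < t" "t \<le> 1"
  shows "X powr t \<le> l powr t * (1 + X / l)"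
proof (cases "X \<le> l")
  case True
  then have "X powr t \<le> l powr t" using assms by (intro powr_mono2) auto
  also have "\<dots> \<le> l powr t * (1 + X / l)" using assms by (simp add: distrib_left)
  finally show ?thesis .
next
  case False
  have "(X / l) powr t \<le> (X / l) powr 1" using assms False by (intro powr_mono) auto
  then have "X powr t \<le> l powr t * (X / l)" using assms by (simp add: powr_divide field_simps)
  also have "\<dots> \<le> l powr t * (1 + X / l)" using assms by (intro mult_left_mono) auto
  finally show ?thesis .
qed

text \<open>The prefactor \<open>(n + 1) powr a\<close> from the Stirling ratio of the degree is compensated by
  \<open>(n + 1) powr (- card J * t)\<close> from the indices in \<open>J\<close>. The exponent \<open>t\<close> replaces \<open>a / 5\<close>, which
  may exceed \<open>1\<close>, in order to use concavity; this is harmless because \<open>X s \<le> 1\<close>.\<close>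

lemma sum_multinomial_term_powr_le:
  fixes a t :: real
  assumes "finite A" "J \<subseteq> A" "\<And>j. 0 \<le> b j" "\<And>j. j \<in> J \<Longrightarrow> 0 < b j" "sum b A \<le> 1"
    and "0 < a" "0 < t" "t \<le> 1" "t \<le> a / 5" "a + 2 \<le> card J * t"
  shows "(\<Sum>s\<in>multi_indices A n. multinomial_term b s powr (1 + a))
    \<le> exp a * (1 + 1 / prod b J) / (real n + 1)\<^sup>2"
proof -
  define X where "X s = (\<Prod>j\<in>J. 1 / (real (s j) + 1))" for s :: "nat \<Rightarrow> nat"
  define N where "N = real n + 1"
  \<comment> \<open>the order of magnitude of the mean of \<open>X\<close>\<close>
  define l where "l = 1 / N ^ card J"
  have N: "N \<ge> 1" and l: "l > 0" by (auto simp: N_def l_def)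
  have X: "0 < X s" "X s \<le> 1" for s unfolding X_def by (auto intro!: prod_pos prod_le_1)
  have pt: "multinomial_term b s powr (1 + a)
      \<le> multinomial_term b s * (exp a * N powr a * l powr t * (1 + X s / l))"
    if s: "s \<in> multi_indices A n" for s
  proof -
    let ?c = "multinomial_term b s"
    have c: "?c \<ge> 0" using assms multinomial_term_nonneg by blast
    have "?c \<le> stirling_ratio n / (\<Prod>j\<in>J. stirling_ratio (s j))"
      by (rule multinomial_term_le_stirling[OF assms(1,2) s assms(3,5)])
    also have "\<dots> \<le> (exp 1 * N) / (\<Prod>j\<in>J. (real (s j) + 1) powr (1 / 5))"
      using stirling_ratio_upper[of n] stirling_ratio_lower stirling_ratio_pos[of n] N
      by (intro frac_le prod_mono prod_pos) (auto simp: N_def add.commute)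
    also have "\<dots> = exp 1 * N * X s powr (1 / 5)"
      unfolding X_def by (subst prod_powr_distrib[symmetric])
        (auto simp: prod_dividef powr_divide prod_nonneg)
    finally have "?c powr a \<le> (exp 1 * N * X s powr (1 / 5)) powr a"
      using c assms by (intro powr_mono2) auto
    also have "\<dots> = exp a * N powr a * X s powr (a / 5)"
      using N X[of s] by (simp add: powr_mult powr_powr exp_powr_real)
    also have "\<dots> \<le> exp a * N powr a * X s powr t"
      using X[of s] assms by (intro mult_left_mono powr_mono') auto
    also have "\<dots> \<le> exp a * N powr a * (l powr t * (1 + X s / l))"
      using X[of s] l assms by (intro mult_left_mono powr_le_scaled_affine) auto
    finally have "?c * ?c powr a \<le> ?c * (exp a * N powr a * l powr t * (1 + X s / l))"
      using c by (intro mult_left_mono) (auto simp: mult.assoc)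
    then show ?thesis using c assms by (simp add: powr_add)
  qed
  have "(\<Sum>s\<in>multi_indices A n. multinomial_term b s powr (1 + a))
    \<le> (\<Sum>s\<in>multi_indices A n. multinomial_term b s * (exp a * N powr a * l powr t * (1 + X s / l)))"
    by (intro sum_mono pt)
  also have "\<dots> = exp a * N powr a * l powr t * ((\<Sum>s\<in>multi_indices A n. multinomial_term b s)
      + (\<Sum>s\<in>multi_indices A n. multinomial_term b s * X s) / l)"
    by (simp add: sum_distrib_left sum.distrib[symmetric] sum_divide_distrib algebra_simps)
  also have "\<dots> \<le> exp a * N powr a * l powr t * (1 + 1 / prod b J)"
  proof (intro mult_left_mono add_mono)
    show "(\<Sum>s\<in>multi_indices A n. multinomial_term b s) \<le> 1"
      using assms by (simp add: sum_multinomial_term power_le_one sum_nonneg)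
    have "(\<Sum>s\<in>multi_indices A n. multinomial_term b s * X s) \<le> 1 / prod b J * l"
      using sum_multinomial_term_reciprocal_le[OF assms(1-5), where n = n] by (simp add: X_def l_def N_def)
    then show "(\<Sum>s\<in>multi_indices A n. multinomial_term b s * X s) / l \<le> 1 / prod b J"
      using l by (simp add: pos_divide_le_eq)
  qed auto
  also have "\<dots> = exp a * (1 + 1 / prod b J) * N powr (a - card J * t)"
    using N by (simp add: l_def powr_diff powr_divide powr_powr powr_realpow[symmetric])
  also have "\<dots> \<le> exp a * (1 + 1 / prod b J) * N powr (- 2)"
    using N assms by (intro mult_left_mono powr_mono add_nonneg_nonneg mult_nonneg_nonneg)
      (auto intro!: prod_nonneg)
  also have "\<dots> = exp a * (1 + 1 / prod b J) / (real n + 1)\<^sup>2"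
    using N by (simp add: powr_minus N_def divide_inverse)
  finally show ?thesis .
qed

section \<open>The characterisation\<close>

lemma l1_norm_le_1_iff:
  assumes "\<And>j. 0 \<le> b j"
  shows "l1_norm b \<le> 1 \<longleftrightarrow> (\<forall>A. finite A \<longrightarrow> sum b A \<le> 1)"
proof
  assume le: "l1_norm b \<le> 1"
  show "\<forall>A. finite A \<longrightarrow> sum b A \<le> 1"
  proof (intro allI impI)
    fix A :: "nat set" assume "finite A"
    then have "(\<Sum>j\<in>A. ennreal \<bar>b j\<bar>) \<le> l1_norm b"
      unfolding l1_norm_def by (intro sum_le_suminf) auto
    also note le
    finally have "ennreal (sum b A) \<le> 1" using assms by (simp add: sum_ennreal)
    then show "sum b A \<le> 1" by simp
  qed
next
  assume *: "\<forall>A. finite A \<longrightarrow> sum b A \<le> 1"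
  show "l1_norm b \<le> 1" unfolding l1_norm_def
  proof (rule suminf_le_const)
    show "(\<Sum>j<n. ennreal \<bar>b j\<bar>) \<le> 1" for n
      using * assms by (simp add: sum_ennreal)
  qed auto
qed

text \<open>A bound on the terms would make \<open>(\<Sum>j\<in>A. b j) ^ n\<close>, the sum of all terms of degree \<open>n\<close> supported
  in \<open>A\<close>, grow at most polynomially in \<open>n\<close>.\<close>

lemma multinomial_term_unbounded:
  assumes "finite A" "1 < sum b A"
  obtains s where "s \<in> finsupp_seqs" "K < multinomial_term b s"
proof (rule ccontr)
  note * = that
  assume "\<not> thesis"
  then have le: "multinomial_term b s \<le> K" if "s \<in> finsupp_seqs" for s
    using that *[of s] by (meson not_le)
  have bound: "sum b A ^ n \<le> max K 0 * (real n + 1) ^ card A" for n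
  proof -
    have "sum b A ^ n = (\<Sum>s\<in>multi_indices A n. multinomial_term b s)"
      using assms by (simp add: sum_multinomial_term)
    also have "\<dots> \<le> (\<Sum>s\<in>multi_indices A n. max K 0)"
    proof (intro sum_mono max.coboundedI1 le)
      fix s assume "s \<in> multi_indices A n"
      then show "s \<in> finsupp_seqs"
        using assms(1) finite_subset[of "supp s" A] by (simp add: multi_indices_def finsupp_seqs_def)
    qed
    also have "\<dots> \<le> (real n + 1) ^ card A * max K 0"
    proof -
      have "real (card (multi_indices A n)) \<le> real ((n + 1) ^ card A)"
        using card_multi_indices[OF assms(1), of n] by (simp only: of_nat_le_iff)
      then show ?thesis unfolding sum_constant by (intro mult_right_mono) (simp_all add: add.commute)
    qed
    finally show ?thesis by (simp add: mult.commute)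
  qed
  \<comment> \<open>At \<open>x = L (1 + n)\<close> the limit \<open>x ^ k / exp x \<longlonglongrightarrow> 0\<close> compares \<open>(1 + n) ^ k\<close> with \<open>sum b A ^ (n + 1)\<close>.\<close>
  define L where "L = ln (sum b A)"
  have L: "0 < L" and expL: "exp (L * (1 + real n)) = sum b A ^ n * sum b A" for n
    using assms(2) by (simp_all add: L_def exp_add distrib_left exp_of_nat2_mult)
  have "filterlim (\<lambda>n. L * (1 + real n)) at_top sequentially"
    using L by (intro filterlim_tendsto_pos_mult_at_top[OF tendsto_const]
      filterlim_tendsto_add_at_top[OF tendsto_const filterlim_real_sequentially])
  then have "(\<lambda>n. (L * (1 + real n)) ^ card A / exp (L * (1 + real n))) \<longlonglongrightarrow> 0"
    by (rule filterlim_compose[OF tendsto_power_div_exp_0])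
  \<comment> \<open>The factor \<open>sum b A\<close> matches the extra factor in \<open>expL\<close>; the summand \<open>1\<close> keeps \<open>M\<close> positive.\<close>
  moreover define M where "M = max K 0 * sum b A + 1"
  moreover have M: "0 < M" using assms(2) by (auto simp: M_def intro: add_nonneg_pos)
  ultimately have "\<forall>\<^sub>F n in sequentially.
      (L * (1 + real n)) ^ card A / exp (L * (1 + real n)) < L ^ card A / M"
    using L by (intro order_tendstoD(2)) auto
  then obtain n where "(L * (1 + real n)) ^ card A / exp (L * (1 + real n)) < L ^ card A / M"
    by (auto simp: eventually_sequentially)
  then have "M * (1 + real n) ^ card A < sum b A ^ n * sum b A"
    using L M assms(2) by (simp add: expL power_mult_distrib divide_simps mult_ac)
  moreover have "sum b A ^ n * sum b A \<le> max K 0 * (real n + 1) ^ card A * sum b A"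
    using bound[of n] assms(2) by (intro mult_right_mono) auto
  moreover have "0 < (1 + real n) ^ card A" by simp
  ultimately show False by (simp add: M_def algebra_simps)
qed

theorem theorem5p2:
  fixes p :: real and b :: "nat \<Rightarrow> real"
  assumes "1 < p"
    and "\<And>j. 0 \<le> b j"
    and "infinite {j. 0 < b j}"
  shows "in_lp p finsupp_seqs
           (\<lambda>s. real (fact (multi_abs s)) / real (multi_fact s) * multi_power b s)
         \<longleftrightarrow> l1_norm b \<le> 1"
  unfolding l1_norm_le_1_iff[OF assms(2)] multinomial_term_def[symmetric]
proof (intro iffI allI impI)
  fix A :: "nat set"
  assume lp: "in_lp p finsupp_seqs (multinomial_term b)" and "finite A"
  show "sum b A \<le> 1"
  proof (rule ccontr)
    assume "\<not> sum b A \<le> 1"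
    let ?S = "infsum (\<lambda>s. \<bar>multinomial_term b s\<bar> powr p) finsupp_seqs"
    \<comment> \<open>The \<open>1\<close> makes the term itself exceed \<open>1\<close>, so that its \<open>p\<close>-th power is even larger.\<close>
    obtain s where s: "s \<in> finsupp_seqs" "max 0 ?S + 1 < multinomial_term b s"
      using multinomial_term_unbounded[of A b "max 0 ?S + 1"] \<open>finite A\<close> \<open>\<not> sum b A \<le> 1\<close>
      by (metis not_le)
    have "multinomial_term b s powr 1 \<le> multinomial_term b s powr p"
      using s assms(1) by (intro powr_mono) auto
    also have "\<dots> = (\<Sum>s\<in>{s}. \<bar>multinomial_term b s\<bar> powr p)" using s by simp
    also have "\<dots> \<le> ?S"
      using lp s unfolding in_lp_def by (intro finite_sum_le_infsum) auto
    finally show False using s by simp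
  qed
next
  assume le: "\<forall>A. finite A \<longrightarrow> sum b A \<le> 1"
  define a where "a = p - 1"
  define t where "t = min 1 (a / 5)"
  have a: "0 < a" and t: "0 < t" "t \<le> 1" "t \<le> a / 5" using assms(1) by (auto simp: a_def t_def min_def)
  \<comment> \<open>This many indices push the exponent \<open>a - card J * t\<close> of \<open>n + 1\<close> down to \<open>-2\<close> or below.\<close>
  obtain J where J: "J \<subseteq> {j. 0 < b j}" "finite J" "card J = nat \<lceil>(a + 2) / t\<rceil>"
    using infinite_arbitrarily_large[OF assms(3)] by blast
  have "(a + 2) / t \<le> card J" unfolding J(3) by (rule real_nat_ceiling_ge)
  then have cJ: "a + 2 \<le> card J * t" using t by (simp add: pos_divide_le_eq)
  define C where "C = exp a * (1 + 1 / prod b J)"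
  have C: "0 \<le> C" using assms(2) by (auto simp: C_def prod_nonneg)
  have sq: "summable (\<lambda>n. C / (real n + 1)\<^sup>2)"
  proof -
    have "summable (\<lambda>n. inverse (real (Suc n) ^ 2))"
      using inverse_power_summable[of 2, where ?'a = real] by (subst summable_Suc_iff) simp
    then show ?thesis using summable_mult[of _ C] by (simp add: divide_inverse add.commute)
  qed
  have bound: "(\<Sum>s\<in>F. multinomial_term b s powr p) \<le> (\<Sum>n. C / (real n + 1)\<^sup>2)"
    if F: "finite F" "F \<subseteq> finsupp_seqs" for F
  proof -
    \<comment> \<open>A finite set of multi-indices lies in finitely many degrees over finitely many indices.\<close>
    define A where "A = J \<union> (\<Union>s\<in>F. supp s)"
    define L where "L = (\<Sum>s\<in>F. sum s A)"
    have A: "finite A" "J \<subseteq> A" using F J by (auto simp: A_def finsupp_seqs_def)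
    have "F \<subseteq> (\<Union>n\<le>L. multi_indices A n)"
      using F(1) member_le_sum[of _ F "\<lambda>s. sum s A"]
      by (auto simp: multi_indices_def A_def L_def)
    then have "(\<Sum>s\<in>F. multinomial_term b s powr p)
        \<le> (\<Sum>s\<in>(\<Union>n\<le>L. multi_indices A n). multinomial_term b s powr p)"
      using A by (intro sum_mono2) (auto simp: finite_multi_indices)
    also have "\<dots> = (\<Sum>n\<le>L. \<Sum>s\<in>multi_indices A n. multinomial_term b s powr p)"
      using A by (intro sum.UNION_disjoint) (auto simp: finite_multi_indices,
        auto simp: multi_indices_def)
    also have "\<dots> \<le> (\<Sum>n\<le>L. C / (real n + 1)\<^sup>2)"
    proof (rule sum_mono)
      fix n
      have pos: "0 < b j" if "j \<in> J" for j using that J(1) by auto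
      have "sum b A \<le> 1" using le A(1) by blast
      from sum_multinomial_term_powr_le[where b = b, OF A assms(2) pos this a t cJ]
      show "(\<Sum>s\<in>multi_indices A n. multinomial_term b s powr p) \<le> C / (real n + 1)\<^sup>2"
        by (simp add: C_def a_def)
    qed
    also have "\<dots> \<le> (\<Sum>n. C / (real n + 1)\<^sup>2)"
      using sq C by (intro sum_le_suminf) auto
    finally show ?thesis .
  qed
  have "(\<lambda>s. multinomial_term b s powr p) summable_on finsupp_seqs"
    using bound by (intro nonneg_bdd_above_summable_on) (auto intro!: bdd_aboveI2)
  then show "in_lp p finsupp_seqs (multinomial_term b)"
    using assms(2) by (simp add: in_lp_def multinomial_term_nonneg)
qed

end
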